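(* Let $\gamma=\min\big(\lceil\alpha^{-1}\rceil,\max_{f\in\mathcal F}|\mathcal G_f|\big)$. The additive fairness violation of the clustering produced by the Flow-APFR problem is at most $$\gamma^{|\mathcal F|-1}+\alpha\,\mathbb I(\gamma>2),$$ where $\mathbb I(\gamma>2)$ equals $1$ if $\gamma>2$ and $0$ otherwise. That is, the binary assignment $\bar{\mathbf z}$ produced by Flow-APFR satisfies, for every group $g$ and cluster $k$ with $y_{gk}=1$, $$\alpha\sum_{x^i\in\mathcal X}\bar z_{ik}-\sum_{x^i\in X_g}\bar z_{ik}\le\gamma^{|\mathcal F|-1}+\alpha\,\mathbb I(\gamma>2).$$
   Context: Setting. The data are $n$ indexed points $\mathcal X=\{x^1,\dots,x^n\}\subset\mathbb R^m$. There is a finite set $\mathcal F$ of sensitive features; each $f\in\mathcal F$ has a finite set of values $\mathcal G_f$, $\mathcal G=\bigcup_f\mathcal G_f$ is the set of groups, $X_g$ is the set of data points in group $g$, and $\{X_g\}_{g\in\mathcal G_f}$ partitions $\mathcal X$ for each $f$. $\mathcal K=\{1,\dots,K\}$ indexes the clusters, with fixed centers $c_1,\dots,c_K$ and assignment costs $D(x^i,c_k)$ (squared Euclidean distance for $k$-means, any given distance function for $k$-medians). $\alpha\in(0,1]$, and $1\le l\le u$ are integers. Assignment Problem under Fixed Representation (APFR). Given fixed $y_{gk}\in\{0,1\}$ ($y_{gk}=1$ means group $g$ must be $\alpha$-represented in cluster $k$), minimize $\sum_{i,k}D(x^i,c_k)z_{ik}$ subject to $\sum_k z_{ik}=1$ for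 all $i$; $\sum_{x^i\in X_g}z_{ik}\ge\alpha\sum_{x^i\in\mathcal X}z_{ik}$ for all $(g,k)$ with $y_{gk}=1$ (the fairness constraints); $l\le\sum_{x^i\in\mathcal X}z_{ik}\le u$ for all $k$; $z_{ik}\in\{0,1\}$. Its linear relaxation replaces $z_{ik}\in\{0,1\}$ by $z_{ik}\in[0,1]$. Let $\mathbf z^{LP}$ be an optimal solution of the linear relaxation. Flow-APFR. For cluster $k$, let $\mathcal F_k$ be the set of features $f$ having some $g\in\mathcal G_f$ with $y_{gk}=1$. The set $T_k$ of types of cluster $k$ consists of all combinations obtained by choosing, for each $f\in\mathcal F_k$, either a group $g\in\mathcal G_f$ with $y_{gk}=1$ or, if there are groups in $\mathcal G_f$ with $y_{gk}=0$, the remainder value "none of the groups of $\mathcal G_f$ represented in $k$". For $t\in T_k$ let $X_t\subseteq\mathcal X$ be the set of data points matching $t$; the sets $X_t$, $t\in T_k$, partition $\mathcal X$. Given $\mathbf z^{LP}$, build a directed network with: - a node $v_i$ with supply $1$ for each $x^i\in\mathcal X$; - for each $k$ and $t\in T_k$ a node $v_{tk}$ with demand $d_{tk}=\lfloor\sum_{x^i\in X_t}z^{LP}_{ik}\rfloor$, and an edge $v_i\to v_{tk}$ of capacity $1$ and cost $D(x^i,c_k)$ for each $x^i\in X_t$; - for each $k$ a node $v_k$ with demand $d_k=\lfloor\sum_{x^i\in\mathcal X}z^{LP}_{ik}\rfloor-\sum_{t\in T_k}d_{tk}$, and an edge $v_{tk}\to v_k$ of capacity $1$ and cost $0$ for each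 $t\in T_k$; - a sink $v_s$ with demand $|\mathcal X|-\sum_k(d_k+\sum_{t\in T_k}d_{tk})$, and an edge $v_k\to v_s$ of capacity $1$ and cost $0$ for each $k$ with $\sum_{x^i\in\mathcal X}z^{LP}_{ik}\notin\mathbb Z$. The Flow-APFR problem is the minimum-cost flow problem on this network; the clustering it produces is read off an integral minimum-cost flow: $\bar z_{ik}=1$ if one unit flows from $v_i$ to some node $v_{tk}$, $t\in T_k$, and $\bar z_{ik}=0$ otherwise. Additive constraint violation: for a constraint $h(x)\le0$, a solution $\bar x$ has additive constraint violation $\delta\ge0$ if $h(\bar x)\le\delta$. *)

theory Defs
  imports "HOL-Analysis.Analysis"
begin

text \<open>
  Points are represented by their indices \<open>1, \<dots>, n\<close>, so that repeated points are counted with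
  multiplicity; \<open>members g\<close> is the set of indices of the points in group \<open>g\<close>.
  The costs \<open>D\<close> are arbitrary, so squared Euclidean distances and
  arbitrary distance functions are both covered.
\<close>

record ('f, 'g, 'm) apfr =
  npoints :: nat
  point :: "nat \<Rightarrow> real ^ 'm"
  nclusters :: nat
  center :: "nat \<Rightarrow> real ^ 'm"
  D :: "real ^ 'm \<Rightarrow> real ^ 'm \<Rightarrow> real"
  features :: "'f set"
  vals :: "'f \<Rightarrow> 'g set"
  members :: "'g \<Rightarrow> nat set"
  alpha :: real
  lower :: nat
  upper :: nat
  rep :: "'g \<Rightarrow> nat \<Rightarrow> nat"

definition points :: "('f, 'g, 'm::finite) apfr \<Rightarrow> nat set" where
  "points P = {1..npoints P}"

definition clusters :: "('f, 'g, 'm::finite) apfr \<Rightarrow> nat set" where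
  "clusters P = {1..nclusters P}"

definition groups :: "('f, 'g, 'm::finite) apfr \<Rightarrow> 'g set" where
  "groups P = (\<Union>f\<in>features P. vals P f)"

definition apfr_instance :: "('f, 'g, 'm::finite) apfr \<Rightarrow> bool" where
  "apfr_instance P \<longleftrightarrow>
     finite (features P) \<and>
     (\<forall>f\<in>features P. finite (vals P f) \<and>
        disjoint_family_on (members P) (vals P f) \<and>
        (\<Union>g\<in>vals P f. members P g) = points P) \<and>
     0 < alpha P \<and> alpha P \<le> 1 \<and>
     1 \<le> lower P \<and> lower P \<le> upper P \<and>
     (\<forall>g\<in>groups P. \<forall>k\<in>clusters P. rep P g k \<in> {0, 1})"

definition assignment_cost :: "('f, 'g, 'm::finite) apfr \<Rightarrow> (nat \<Rightarrow> nat \<Rightarrow> real) \<Rightarrow> real" where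
  "assignment_cost P z =
     (\<Sum>i\<in>points P. \<Sum>k\<in>clusters P. D P (point P i) (center P k) * z i k)"

definition lp_feasible :: "('f, 'g, 'm::finite) apfr \<Rightarrow> (nat \<Rightarrow> nat \<Rightarrow> real) \<Rightarrow> bool" where
  "lp_feasible P z \<longleftrightarrow>
     (\<forall>i\<in>points P. (\<Sum>k\<in>clusters P. z i k) = 1) \<and>
     (\<forall>g\<in>groups P. \<forall>k\<in>clusters P. rep P g k = 1 \<longrightarrow>
        (\<Sum>i\<in>members P g. z i k) \<ge> alpha P * (\<Sum>i\<in>points P. z i k)) \<and>
     (\<forall>k\<in>clusters P. real (lower P) \<le> (\<Sum>i\<in>points P. z i k) \<and>
        (\<Sum>i\<in>points P. z i k) \<le> real (upper P)) \<and>
     (\<forall>i\<in>points P. \<forall>k\<in>clusters P. z i k \<in> {0..1})"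

definition lp_optimal :: "('f, 'g, 'm::finite) apfr \<Rightarrow> (nat \<Rightarrow> nat \<Rightarrow> real) \<Rightarrow> bool" where
  "lp_optimal P z \<longleftrightarrow>
     lp_feasible P z \<and> (\<forall>w. lp_feasible P w \<longrightarrow> assignment_cost P z \<le> assignment_cost P w)"


text \<open>Supplies are positive and demands are negative values of \<open>net_supply\<close>.\<close>

record 'v network =
  nodes :: "'v set"
  edges :: "('v \<times> 'v) set"
  capacity :: "'v \<times> 'v \<Rightarrow> real"
  edge_cost :: "'v \<times> 'v \<Rightarrow> real"
  net_supply :: "'v \<Rightarrow> real"

definition feasible_flow :: "'v network \<Rightarrow> ('v \<times> 'v \<Rightarrow> real) \<Rightarrow> bool" where
  "feasible_flow N \<phi> \<longleftrightarrow>
     (\<forall>e\<in>edges N. 0 \<le> \<phi> e \<and> \<phi> e \<le> capacity N e) \<and>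
     (\<forall>v\<in>nodes N.
        (\<Sum>e\<in>{e\<in>edges N. fst e = v}. \<phi> e) - (\<Sum>e\<in>{e\<in>edges N. snd e = v}. \<phi> e) = net_supply N v)"

definition flow_cost :: "'v network \<Rightarrow> ('v \<times> 'v \<Rightarrow> real) \<Rightarrow> real" where
  "flow_cost N \<phi> = (\<Sum>e\<in>edges N. edge_cost N e * \<phi> e)"

definition min_cost_flow :: "'v network \<Rightarrow> ('v \<times> 'v \<Rightarrow> real) \<Rightarrow> bool" where
  "min_cost_flow N \<phi> \<longleftrightarrow>
     feasible_flow N \<phi> \<and> (\<forall>\<psi>. feasible_flow N \<psi> \<longrightarrow> flow_cost N \<phi> \<le> flow_cost N \<psi>)"

definition integral_flow :: "'v network \<Rightarrow> ('v \<times> 'v \<Rightarrow> real) \<Rightarrow> bool" where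
  "integral_flow N \<phi> \<longleftrightarrow> (\<forall>e\<in>edges N. \<phi> e \<in> \<int>)"


definition cluster_features :: "('f, 'g, 'm::finite) apfr \<Rightarrow> nat \<Rightarrow> 'f set" where
  "cluster_features P k = {f\<in>features P. \<exists>g\<in>vals P f. rep P g k = 1}"

text \<open>
  In a type, \<open>None\<close> stands for the remainder value of a feature, that is, for
  belonging to no group of that feature that is represented in the cluster.
\<close>

definition types :: "('f, 'g, 'm::finite) apfr \<Rightarrow> nat \<Rightarrow> ('f \<Rightarrow> 'g option) set" where
  "types P k = (\<Pi>\<^sub>E f\<in>cluster_features P k.
     Some ` {g\<in>vals P f. rep P g k = 1} \<union>
     (if \<exists>g\<in>vals P f. rep P g k = 0 then {None} else {}))"

definition matching :: "('f, 'g, 'm::finite) apfr \<Rightarrow> nat \<Rightarrow> ('f \<Rightarrow> 'g option) \<Rightarrow> nat set" where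
  "matching P k t = {i\<in>points P. \<forall>f\<in>cluster_features P k.
     (case t f of
        Some g \<Rightarrow> i \<in> members P g
      | None \<Rightarrow> \<forall>g\<in>vals P f. rep P g k = 1 \<longrightarrow> i \<notin> members P g)}"

datatype ('f, 'g) node =
  Point nat | Type "'f \<Rightarrow> 'g option" nat | Cluster nat | Sink

definition type_demand ::
  "('f, 'g, 'm::finite) apfr \<Rightarrow> (nat \<Rightarrow> nat \<Rightarrow> real) \<Rightarrow> ('f \<Rightarrow> 'g option) \<Rightarrow> nat \<Rightarrow> int" where
  "type_demand P z t k = \<lfloor>\<Sum>i\<in>matching P k t. z i k\<rfloor>"

definition cluster_demand ::
  "('f, 'g, 'm::finite) apfr \<Rightarrow> (nat \<Rightarrow> nat \<Rightarrow> real) \<Rightarrow> nat \<Rightarrow> int" where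
  "cluster_demand P z k = \<lfloor>\<Sum>i\<in>points P. z i k\<rfloor> - (\<Sum>t\<in>types P k. type_demand P z t k)"

definition sink_demand :: "('f, 'g, 'm::finite) apfr \<Rightarrow> (nat \<Rightarrow> nat \<Rightarrow> real) \<Rightarrow> int" where
  "sink_demand P z = int (card (points P)) -
     (\<Sum>k\<in>clusters P. cluster_demand P z k + (\<Sum>t\<in>types P k. type_demand P z t k))"

definition flow_apfr ::
  "('f, 'g, 'm::finite) apfr \<Rightarrow> (nat \<Rightarrow> nat \<Rightarrow> real) \<Rightarrow> ('f, 'g) node network" where
  "flow_apfr P z = \<lparr>
     nodes = Point ` points P \<union> {Type t k | t k. k \<in> clusters P \<and> t \<in> types P k} \<union>
       Cluster ` clusters P \<union> {Sink},
     edges =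
       {(Point i, Type t k) | i t k. k \<in> clusters P \<and> t \<in> types P k \<and> i \<in> matching P k t} \<union>
       {(Type t k, Cluster k) | t k. k \<in> clusters P \<and> t \<in> types P k} \<union>
       {(Cluster k, Sink) | k. k \<in> clusters P \<and> (\<Sum>i\<in>points P. z i k) \<notin> \<int>},
     capacity = (\<lambda>_. 1),
     edge_cost = (\<lambda>e. case e of
         (Point i, Type t k) \<Rightarrow> D P (point P i) (center P k)
       | _ \<Rightarrow> 0),
     net_supply = (\<lambda>v. case v of
         Point i \<Rightarrow> 1
       | Type t k \<Rightarrow> - of_int (type_demand P z t k)
       | Cluster k \<Rightarrow> - of_int (cluster_demand P z k)
       | Sink \<Rightarrow> - of_int (sink_demand P z)) \<rparr>"

text \<open>The guard \<open>i \<in> matching P k t\<close> says that the pair is an edge of the network; flows are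
  unconstrained on other pairs.\<close>

definition flow_assignment ::
  "('f, 'g, 'm::finite) apfr \<Rightarrow> (('f, 'g) node \<times> ('f, 'g) node \<Rightarrow> real) \<Rightarrow> nat \<Rightarrow> nat \<Rightarrow> real" where
  "flow_assignment P \<phi> i k =
     (if \<exists>t\<in>types P k. i \<in> matching P k t \<and> \<phi> (Point i, Type t k) = 1 then 1 else 0)"


definition additive_violation :: "('x \<Rightarrow> real) \<Rightarrow> 'x \<Rightarrow> real \<Rightarrow> bool" where
  "additive_violation h x \<delta> \<longleftrightarrow> 0 \<le> \<delta> \<and> h x \<le> \<delta>"

text \<open>Left-hand side of the fairness constraint for \<open>(g, k)\<close> written as \<open>h(z) \<le> 0\<close>.\<close>

definition fairness_lhs ::
  "('f, 'g, 'm::finite) apfr \<Rightarrow> 'g \<Rightarrow> nat \<Rightarrow> (nat \<Rightarrow> nat \<Rightarrow> real) \<Rightarrow> real" where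
  "fairness_lhs P g k z = alpha P * (\<Sum>i\<in>points P. z i k) - (\<Sum>i\<in>members P g. z i k)"

definition gamma :: "('f, 'g, 'm::finite) apfr \<Rightarrow> nat" where
  "gamma P = min (nat \<lceil>inverse (alpha P)\<rceil>) (MAX f\<in>features P. card (vals P f))"

end

theory Submission imports Defs begin

text \<open>
  Fix a cluster \<open>k\<close>, a feature \<open>f\<close> and a group \<open>g\<close> of \<open>f\<close> that is represented in \<open>k\<close>. Write
  \<open>a t\<close> for the fractional mass of type \<open>t\<close>, \<open>x t\<close> for the number of points that the flow sends to
  the node of type \<open>t\<close>, \<open>s\<close> for the total mass, \<open>T\<close> for the set of types and \<open>U\<close> for
  those whose value at \<open>f\<close> is \<open>g\<close>. Since types partition the points and refine \<open>g\<close>, the violation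
  is \<open>\<alpha> * sum x T - sum x U\<close>, and fractional fairness reads \<open>\<alpha> * s \<le> sum a U\<close>.

  Flow conservation together with the unit capacities confines \<open>x t\<close> to \<open>[\<lfloor>a t\<rfloor>, \<lfloor>a t\<rfloor> + 1]\<close>
  (\<open>type_inflow_bounds\<close>) and \<open>sum x T\<close> to at most \<open>\<lceil>s\<rceil>\<close> (\<open>cluster_inflow_le\<close>). A type in
  \<open>U\<close> can lose mass only if its mass is positive. So if \<open>N\<close> bounds the number of such types, then
  \<open>sum x U \<ge> sum a U - N\<close>, and rounding \<open>s\<close> up costs at most another \<open>\<alpha>\<close>.

  The number \<open>N = \<gamma> ^ (card F - 1)\<close> is right because every feature other than \<open>f\<close> contributes at
  most \<open>\<gamma>\<close> values (\<open>card_active_values_le\<close>): its represented groups are disjoint and each has at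
  least the fraction \<open>\<alpha>\<close> of the mass, so there are at most \<open>1 / \<alpha>\<close> of them, and strictly fewer if
  the remainder value also carries mass; moreover, the remainder value exists only if some group is
  not represented.

  For \<open>\<gamma> \<le> 2\<close> the extra \<open>\<alpha>\<close> disappears, for two different reasons. If \<open>1 / \<alpha>\<close> is an integer,
  then \<open>\<lceil>s\<rceil>\<close> is at most the integer \<open>((\<Sum>t\<in>U. \<lfloor>a t\<rfloor>) + N) / \<alpha>\<close>
  (\<open>rounding_violation_le_card_if_inverse_integral\<close>). Otherwise every
  feature has at most \<open>\<gamma>\<close> values, massless ones included, so neither \<open>U\<close> nor its complement has
  more than \<open>N\<close> types. The violation is
  \<open>\<alpha> * sum x (T - U) - (1 - \<alpha>) * sum x U\<close>; with \<open>a\<close> for \<open>x\<close> it would be at most \<open>0\<close> by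
  fairness, and rounding raises it by at most
  \<open>\<alpha> * N + (1 - \<alpha>) * N = N\<close> (\<open>rounding_violation_le_card_if_balanced\<close>).
\<close>


section \<open>Rounding a fractional profile over types\<close>

lemma sum_le_sum_floor_plus_card_positive:
  fixes a :: "'t \<Rightarrow> real"
  assumes "finite U" and nonneg: "\<And>t. t \<in> U \<Longrightarrow> 0 \<le> a t"
    and N: "card {t\<in>U. 0 < a t} \<le> N"
  shows "sum a U \<le> real_of_int (\<Sum>t\<in>U. \<lfloor>a t\<rfloor>) + real N"
proof -
  have "sum a U \<le> (\<Sum>t\<in>U. real_of_int \<lfloor>a t\<rfloor> + (if 0 < a t then 1 else 0))"
  proof (rule sum_mono)
    fix t assume "t \<in> U"
    then have "0 \<le> a t" by (rule nonneg)
    then show "a t \<le> real_of_int \<lfloor>a t\<rfloor> + (if 0 < a t then 1 else 0)"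
      by (cases "a t = 0") (auto intro: less_imp_le)
  qed
  also have "\<dots> = real_of_int (\<Sum>t\<in>U. \<lfloor>a t\<rfloor>) + real (card {t\<in>U. 0 < a t})"
    using \<open>finite U\<close> by (simp add: sum.distrib sum.If_cases Int_def)
  finally show ?thesis using N by linarith
qed

text \<open>
  In the next two lemmas \<open>U\<close> stands for the types of one group, \<open>s\<close> for the fractional and
  \<open>X\<close> for the rounded size of the cluster. Rounding \<open>s\<close> up adds less than \<open>1\<close>, hence
  less than \<open>\<alpha>\<close> to the required size of the group.
\<close>

lemma rounding_violation_le_card_plus_alpha:
  fixes a x :: "'t \<Rightarrow> real"
  assumes "finite U" and nonneg: "\<And>t. t \<in> U \<Longrightarrow> 0 \<le> a t"
    and N: "card {t\<in>U. 0 < a t} \<le> N"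
    and alpha: "0 < \<alpha>" and fair: "\<alpha> * s \<le> sum a U"
    and x: "\<And>t. t \<in> U \<Longrightarrow> real_of_int \<lfloor>a t\<rfloor> \<le> x t"
    and X: "X \<le> real_of_int \<lceil>s\<rceil>"
  shows "\<alpha> * X - sum x U \<le> real N + \<alpha>"
proof -
  have "\<alpha> * X \<le> \<alpha> * (s + 1)"
    using X alpha by (intro mult_left_mono) linarith+
  moreover have "real_of_int (\<Sum>t\<in>U. \<lfloor>a t\<rfloor>) \<le> sum x U"
    using x by (simp add: sum_mono)
  ultimately show ?thesis
    using sum_le_sum_floor_plus_card_positive[OF \<open>finite U\<close> nonneg N] fair
    by (simp add: distrib_left)
qed

text \<open>
  With \<open>q = 1 / \<alpha>\<close> an integer, fairness gives \<open>s \<le> q * L\<close> for the integer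
  \<open>L = (\<Sum>t\<in>U. \<lfloor>a t\<rfloor>) + N\<close>. The right-hand side is itself an integer, so the rounded size
  obeys the same bound.
\<close>

lemma rounding_violation_le_card_if_inverse_integral:
  fixes a x :: "'t \<Rightarrow> real"
  assumes "finite U" and nonneg: "\<And>t. t \<in> U \<Longrightarrow> 0 \<le> a t"
    and N: "card {t\<in>U. 0 < a t} \<le> N"
    and alpha: "0 < \<alpha>" "inverse \<alpha> \<in> \<int>" and fair: "\<alpha> * s \<le> sum a U"
    and x: "\<And>t. t \<in> U \<Longrightarrow> real_of_int \<lfloor>a t\<rfloor> \<le> x t"
    and X: "X \<le> real_of_int \<lceil>s\<rceil>"
  shows "\<alpha> * X - sum x U \<le> real N"
proof -
  obtain q where q: "inverse \<alpha> = real_of_int q" using alpha(2) by (elim Ints_cases)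
  let ?L = "(\<Sum>t\<in>U. \<lfloor>a t\<rfloor>) + int N"
  have "\<alpha> * s \<le> real_of_int ?L"
    using sum_le_sum_floor_plus_card_positive[OF \<open>finite U\<close> nonneg N] fair by simp
  then have "inverse \<alpha> * (\<alpha> * s) \<le> inverse \<alpha> * real_of_int ?L"
    using alpha(1) by (intro mult_left_mono) auto
  moreover have "inverse \<alpha> * (\<alpha> * s) = s" using alpha(1) by simp
  ultimately have "s \<le> real_of_int (q * ?L)" by (simp only: q of_int_mult)
  then have "\<lceil>s\<rceil> \<le> q * ?L" by (simp only: ceiling_le_iff)
  then have "X \<le> real_of_int q * real_of_int ?L"
    using X by (metis of_int_le_iff of_int_mult order_trans)
  then have "\<alpha> * X \<le> \<alpha> * (inverse \<alpha> * real_of_int ?L)"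
    using alpha(1) q by (intro mult_left_mono) auto
  also have "\<dots> = real_of_int ?L" using alpha(1) by simp
  finally have "\<alpha> * X \<le> real_of_int ?L" .
  moreover have "real_of_int (\<Sum>t\<in>U. \<lfloor>a t\<rfloor>) \<le> sum x U"
    using x by (simp add: sum_mono)
  ultimately show ?thesis by simp
qed

text \<open>
  With \<open>T\<close> the set of all types, the violation equals
  \<open>\<alpha> * sum x (T - U) - (1 - \<alpha>) * sum x U\<close>. The first sum exceeds its
  fractional counterpart by at most \<open>N\<close>, the second falls short by at most \<open>N\<close>, and the weights
  add up to \<open>1\<close>.
\<close>

lemma rounding_violation_le_card_if_balanced:
  fixes a x :: "'t \<Rightarrow> real"
  assumes "finite T" "U \<subseteq> T"
    and cards: "card U \<le> N" "card (T - U) \<le> N"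
    and alpha: "0 < \<alpha>" "\<alpha> \<le> 1" and fair: "\<alpha> * sum a T \<le> sum a U"
    and x: "\<And>t. t \<in> T \<Longrightarrow> real_of_int \<lfloor>a t\<rfloor> \<le> x t"
      "\<And>t. t \<in> T \<Longrightarrow> x t \<le> real_of_int \<lfloor>a t\<rfloor> + 1"
  shows "\<alpha> * sum x T - sum x U \<le> real N"
proof -
  have split: "sum h T = sum h (T - U) + sum h U" for h :: "'t \<Rightarrow> real"
    using assms(1,2) by (simp add: sum.subset_diff)
  have "sum x (T - U) \<le> (\<Sum>t\<in>T - U. a t + 1)"
    using x(2) by (intro sum_mono) (smt (verit) DiffD1 of_int_floor_le)
  also have "\<dots> \<le> sum a (T - U) + real N"
    using cards(2) by (simp add: sum.distrib)
  finally have "\<alpha> * sum x (T - U) \<le> \<alpha> * (sum a (T - U) + real N)"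
    using alpha(1) by (intro mult_left_mono) auto
  moreover
  have "(\<Sum>t\<in>U. a t - 1) \<le> sum x U"
  proof (rule sum_mono)
    fix t assume "t \<in> U"
    then have "real_of_int \<lfloor>a t\<rfloor> \<le> x t" using x(1) assms(2) by blast
    then show "a t - 1 \<le> x t" by linarith
  qed
  then have "sum a U - real N \<le> sum x U"
    using cards(1) by (simp add: sum_subtractf)
  then have "(1 - \<alpha>) * (sum a U - real N) \<le> (1 - \<alpha>) * sum x U"
    using alpha(2) by (intro mult_left_mono) auto
  ultimately show ?thesis
    using fair by (simp add: split algebra_simps)
qed


section \<open>Types of a cluster\<close>

locale fair_cluster =
  fixes P :: "('f, 'g, 'm::finite) apfr" and z :: "nat \<Rightarrow> nat \<Rightarrow> real" and k :: nat
  assumes inst: "apfr_instance P" and feas: "lp_feasible P z" and k: "k \<in> clusters P"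
begin

definition represented :: "'f \<Rightarrow> 'g set" where
  "represented f = {g\<in>vals P f. rep P g k = 1}"

definition type_values :: "'f \<Rightarrow> 'g option set" where
  "type_values f = Some ` represented f \<union> (if \<exists>g\<in>vals P f. rep P g k = 0 then {None} else {})"

definition has_value :: "nat \<Rightarrow> 'f \<Rightarrow> 'g option \<Rightarrow> bool" where
  "has_value i f v = (case v of
     Some g \<Rightarrow> i \<in> members P g
   | None \<Rightarrow> \<forall>g\<in>represented f. i \<notin> members P g)"

lemma types_eq: "types P k = (\<Pi>\<^sub>E f\<in>cluster_features P k. type_values f)"
  by (simp add: types_def type_values_def represented_def)

lemma matching_eq:
  "matching P k t = {i\<in>points P. \<forall>f\<in>cluster_features P k. has_value i f (t f)}"
  by (auto simp: matching_def has_value_def represented_def split: option.splits)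

lemma cluster_features_subset: "cluster_features P k \<subseteq> features P"
  by (auto simp: cluster_features_def)

lemma finite_features: "finite (features P)"
  using inst by (simp add: apfr_instance_def)

lemma finite_cluster_features: "finite (cluster_features P k)"
  using finite_subset[OF cluster_features_subset finite_features] .

lemma finite_vals: "f \<in> features P \<Longrightarrow> finite (vals P f)"
  using inst by (simp add: apfr_instance_def)

lemma represented_subset: "represented f \<subseteq> vals P f"
  by (auto simp: represented_def)

lemma finite_represented: "f \<in> features P \<Longrightarrow> finite (represented f)"
  using finite_vals represented_subset finite_subset by metis

lemma finite_type_values: "f \<in> features P \<Longrightarrow> finite (type_values f)"
  by (simp add: type_values_def finite_represented)

lemma finite_types: "finite (types P k)"
  unfolding types_eq
  using finite_cluster_features finite_type_values cluster_features_subset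
  by (intro finite_PiE) auto

lemma finite_points: "finite (points P)"
  by (simp add: points_def)

lemma finite_matching: "finite (matching P k t)"
  using finite_points by (simp add: matching_eq)

lemma members_subset: "f \<in> features P \<Longrightarrow> g \<in> vals P f \<Longrightarrow> members P g \<subseteq> points P"
  using inst unfolding apfr_instance_def by blast

lemma members_unique:
  "f \<in> features P \<Longrightarrow> g \<in> vals P f \<Longrightarrow> g' \<in> vals P f \<Longrightarrow> i \<in> members P g \<Longrightarrow> i \<in> members P g'
    \<Longrightarrow> g = g'"
  using inst unfolding apfr_instance_def disjoint_family_on_def by blast

text \<open>
  For one feature the represented groups and their common complement partition the points. The
  remainder value is available whenever a point needs it, because the point's own group
  is then an unrepresented group of the feature.
\<close>

lemma ex1_type_value:
  assumes f: "f \<in> features P" and i: "i \<in> points P"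
  shows "\<exists>!v. v \<in> type_values f \<and> has_value i f v"
proof -
  obtain g where g: "g \<in> vals P f" "i \<in> members P g"
    using inst f i unfolding apfr_instance_def by blast
  have "rep P g k \<in> {0, 1}"
    using inst f g(1) k unfolding apfr_instance_def groups_def by blast
  then consider "g \<in> represented f" | "rep P g k = 0"
    using g(1) by (auto simp: represented_def)
  then show ?thesis
  proof cases
    case 1
    show ?thesis
    proof (rule ex1I[of _ "Some g"])
      show "Some g \<in> type_values f \<and> has_value i f (Some g)"
        using 1 g(2) by (simp add: type_values_def has_value_def)
    next
      fix v assume v: "v \<in> type_values f \<and> has_value i f v"
      then show "v = Some g"
        using 1 g members_unique[OF f] represented_subset[of f]
        by (cases v) (auto simp: type_values_def has_value_def split: if_splits)
    qed
  next
    case 2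
    have out: "i \<notin> members P g'" if "g' \<in> represented f" for g'
      using that 2 g members_unique[OF f, of g' g i] by (auto simp: represented_def)
    show ?thesis
    proof (rule ex1I[of _ None])
      show "None \<in> type_values f \<and> has_value i f None"
        using 2 g(1) out by (auto simp: type_values_def has_value_def)
    next
      fix v assume "v \<in> type_values f \<and> has_value i f v"
      then show "v = None"
        using out by (cases v) (auto simp: type_values_def has_value_def split: if_splits)
    qed
  qed
qed

lemma types_cover:
  assumes "i \<in> points P"
  shows "\<exists>t\<in>types P k. i \<in> matching P k t"
proof -
  have "\<forall>f\<in>cluster_features P k. \<exists>v. v \<in> type_values f \<and> has_value i f v"
    using ex1_type_value[OF _ assms] cluster_features_subset by blast
  then obtain h where h: "\<forall>f\<in>cluster_features P k. h f \<in> type_values f \<and> has_value i f (h f)"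
    by metis
  then have "restrict h (cluster_features P k) \<in> types P k"
    "i \<in> matching P k (restrict h (cluster_features P k))"
    using assms by (auto simp: types_eq matching_eq)
  then show ?thesis by blast
qed

lemma type_unique:
  assumes "t \<in> types P k" "t' \<in> types P k" "i \<in> matching P k t" "i \<in> matching P k t'"
  shows "t = t'"
proof (rule PiE_ext)
  show "t \<in> (\<Pi>\<^sub>E f\<in>cluster_features P k. type_values f)"
    "t' \<in> (\<Pi>\<^sub>E f\<in>cluster_features P k. type_values f)"
    using assms(1,2) by (simp_all add: types_eq)
next
  fix f assume "f \<in> cluster_features P k"
  then show "t f = t' f"
    using assms ex1_type_value[of f i] cluster_features_subset
    unfolding types_eq matching_eq by blast
qed

lemma sum_points_by_type:
  fixes w :: "nat \<Rightarrow> real"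
  shows "(\<Sum>i\<in>points P. w i) = (\<Sum>t\<in>types P k. \<Sum>i\<in>matching P k t. w i)"
proof -
  have "points P = (\<Union>t\<in>types P k. matching P k t)"
    using types_cover by (auto simp: matching_eq)
  then show ?thesis
    using finite_types finite_matching type_unique
    by (simp only:) (intro sum.UNION_disjoint, auto)
qed

text \<open>
  Types refine a represented group \<open>g\<close> of a feature of the cluster: the points of \<open>g\<close> are
  exactly those whose type has the value \<open>g\<close> there. This and the preceding lemma turn the fairness
  constraint for \<open>g\<close> into one about sums over types, both for the fractional and the rounded
  assignment.
\<close>

lemma sum_members_by_type:
  fixes w :: "nat \<Rightarrow> real"
  assumes f: "f \<in> cluster_features P k" and g: "g \<in> represented f"
  shows "(\<Sum>i\<in>members P g. w i) = (\<Sum>t\<in>{t\<in>types P k. t f = Some g}. \<Sum>i\<in>matching P k t. w i)"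
proof -
  have f': "f \<in> features P" using f cluster_features_subset by blast
  have gv: "Some g \<in> type_values f" using g by (simp add: type_values_def)
  have "members P g = (\<Union>t\<in>{t\<in>types P k. t f = Some g}. matching P k t)"
  proof (intro equalityI subsetI)
    fix i assume i: "i \<in> members P g"
    then have ip: "i \<in> points P" using members_subset[OF f'] g represented_subset by blast
    then obtain t where t: "t \<in> types P k" "i \<in> matching P k t" using types_cover by blast
    moreover have "t f \<in> type_values f" "has_value i f (t f)"
      using t f unfolding types_eq matching_eq by blast+
    then have "t f = Some g"
      using ex1_type_value[OF f' ip] gv i by (auto simp: has_value_def)
    ultimately show "i \<in> (\<Union>t\<in>{t\<in>types P k. t f = Some g}. matching P k t)" by blast
  next
    fix i assume "i \<in> (\<Union>t\<in>{t\<in>types P k. t f = Some g}. matching P k t)"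
    then obtain t where "t f = Some g" "i \<in> matching P k t" by blast
    then have "has_value i f (Some g)" using f unfolding matching_eq by force
    then show "i \<in> members P g" by (simp add: has_value_def)
  qed
  then show ?thesis
    using finite_types finite_matching type_unique
    by (simp only:) (intro sum.UNION_disjoint, auto)
qed


section \<open>Counting the values and types that matter\<close>

lemma z_nonneg: "i \<in> points P \<Longrightarrow> 0 \<le> z i k"
  using feas k by (simp add: lp_feasible_def)

lemma mass_ge_1: "1 \<le> (\<Sum>i\<in>points P. z i k)"
proof -
  have "1 \<le> real (lower P)" using inst by (simp add: apfr_instance_def)
  then show ?thesis using feas k unfolding lp_feasible_def by fastforce
qed

lemma alpha_bounds: "0 < alpha P" "alpha P \<le> 1"
  using inst by (simp_all add: apfr_instance_def)

lemma fair_lp: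
  assumes "f \<in> features P" "g \<in> represented f"
  shows "alpha P * (\<Sum>i\<in>points P. z i k) \<le> (\<Sum>i\<in>members P g. z i k)"
  using feas k assms unfolding lp_feasible_def groups_def represented_def by blast

text \<open>
  The represented groups are disjoint and each takes at least the fraction \<open>alpha P\<close> of the mass
  of the cluster. The set \<open>R\<close> lies outside all of them; taking for it the points of a type with a
  remainder value shows that a remainder with mass leaves room for fewer represented groups.
\<close>

lemma represented_mass:
  assumes f: "f \<in> features P" and R: "R \<subseteq> points P"
    and disj: "\<And>g. g \<in> represented f \<Longrightarrow> members P g \<inter> R = {}"
  shows "real (card (represented f)) * alpha P * (\<Sum>i\<in>points P. z i k) + (\<Sum>i\<in>R. z i k)
    \<le> (\<Sum>i\<in>points P. z i k)"
proof -
  let ?M = "\<Union>g\<in>represented f. members P g"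
  have sub: "?M \<subseteq> points P" using members_subset[OF f] represented_subset by blast
  have "real (card (represented f)) * alpha P * (\<Sum>i\<in>points P. z i k)
      = (\<Sum>g\<in>represented f. alpha P * (\<Sum>i\<in>points P. z i k))" by simp
  also have "\<dots> \<le> (\<Sum>g\<in>represented f. \<Sum>i\<in>members P g. z i k)"
    using fair_lp[OF f] by (rule sum_mono)
  also have "\<dots> = (\<Sum>i\<in>?M. z i k)"
  proof (rule sum.UNION_disjoint[symmetric])
    show "finite (represented f)" by (rule finite_represented[OF f])
    show "\<forall>g\<in>represented f. finite (members P g)"
      using sub finite_points by (metis UN_subset_iff finite_subset)
    show "\<forall>g\<in>represented f. \<forall>g'\<in>represented f. g \<noteq> g' \<longrightarrow> members P g \<inter> members P g' = {}"
      using members_unique[OF f] represented_subset by blast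
  qed
  finally have "real (card (represented f)) * alpha P * (\<Sum>i\<in>points P. z i k) + (\<Sum>i\<in>R. z i k)
      \<le> (\<Sum>i\<in>?M. z i k) + (\<Sum>i\<in>R. z i k)" by simp
  also have "\<dots> = (\<Sum>i\<in>?M \<union> R. z i k)"
    using finite_subset[OF sub finite_points] finite_subset[OF R finite_points] disj
    by (intro sum.union_disjoint[symmetric]) auto
  also have "\<dots> \<le> (\<Sum>i\<in>points P. z i k)"
    using sub R z_nonneg finite_points by (intro sum_mono2) auto
  finally show ?thesis .
qed

lemma card_represented_le:
  assumes "f \<in> features P"
  shows "real (card (represented f)) * alpha P \<le> 1"
  using represented_mass[OF assms, of "{}"] mass_ge_1 by simp

lemma card_represented_less_if_remainder:
  assumes f: "f \<in> cluster_features P k" and t: "t f = None"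
    and pos: "0 < (\<Sum>i\<in>matching P k t. z i k)"
  shows "real (card (represented f)) * alpha P < 1"
proof -
  let ?s = "\<Sum>i\<in>points P. z i k"
  have "has_value i f None" if "i \<in> matching P k t" for i
    using that t f unfolding matching_eq by force
  then have "members P g \<inter> matching P k t = {}" if "g \<in> represented f" for g
    using that by (auto simp: has_value_def)
  then have "real (card (represented f)) * alpha P * ?s + (\<Sum>i\<in>matching P k t. z i k) \<le> ?s"
    using f cluster_features_subset by (intro represented_mass) (auto simp: matching_eq)
  then have "real (card (represented f)) * alpha P * ?s < 1 * ?s" using pos by simp
  then show ?thesis using mass_ge_1 by (simp only: mult_less_cancel_right)
qed

lemma card_represented_less_if_not_integral:
  assumes f: "f \<in> features P" and nonint: "inverse (alpha P) \<notin> \<int>"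
  shows "real (card (represented f)) * alpha P < 1"
proof (rule ccontr)
  assume "\<not> ?thesis"
  then have "real (card (represented f)) * alpha P = 1" using card_represented_le[OF f] by simp
  then have "inverse (alpha P) = real (card (represented f))"
    using alpha_bounds(1) by (simp add: field_simps)
  then show False using nonint by simp
qed

text \<open>
  The values over which types have to be counted: the remainder value is dropped exactly when
  \<open>1 / alpha P\<close> groups are represented. These then exhaust the mass of the cluster, and counting
  the remainder on top of them would exceed \<open>gamma P\<close> by one.
\<close>

definition active_values :: "'f \<Rightarrow> 'g option set" where
  "active_values f =
     {v\<in>type_values f. v = None \<longrightarrow> real (card (represented f)) * alpha P < 1}"

text \<open>
  With \<open>r\<close> represented groups, the count is \<open>r\<close> or, if the remainder value is active,
  \<open>r + 1\<close>. In the latter case \<open>r\<close> is strictly below both \<open>1 / alpha P\<close> and the number of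
  groups, which pays for the additional value.
\<close>

lemma card_active_values_le:
  assumes f: "f \<in> features P"
  shows "card (active_values f) \<le> gamma P"
proof -
  have fin: "finite (active_values f)"
    using finite_type_values[OF f] by (simp add: active_values_def)
  have sub: "active_values f \<subseteq> insert None (Some ` represented f)"
    by (auto simp: active_values_def type_values_def split: if_splits)
  have card_Some: "card (Some ` represented f) = card (represented f)"
    by (simp add: card_image)
  have "card (active_values f) \<le> nat \<lceil>inverse (alpha P)\<rceil> \<and> card (active_values f) \<le> card (vals P f)"
  proof (cases "None \<in> active_values f")
    case True
    have "card (active_values f) \<le> card (insert None (Some ` represented f))"
      using sub finite_represented[OF f] by (intro card_mono) auto
    then have c: "card (active_values f) \<le> card (represented f) + 1"
      using finite_represented[OF f] card_Some by (simp add: card_insert_if image_iff)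
    have "real (card (represented f)) * alpha P < 1"
      using True by (simp add: active_values_def)
    then have "real (card (represented f)) < inverse (alpha P)"
      using alpha_bounds(1) by (simp add: field_simps)
    then have "int (card (represented f)) < \<lceil>inverse (alpha P)\<rceil>"
      by (simp add: less_ceiling_iff)
    moreover obtain g where "g \<in> vals P f" "rep P g k = 0"
      using True by (auto simp: active_values_def type_values_def split: if_splits)
    then have "g \<in> vals P f" "g \<notin> represented f"
      by (simp_all add: represented_def)
    then have "represented f \<subset> vals P f" using represented_subset by blast
    then have "card (represented f) < card (vals P f)"
      by (intro psubset_card_mono finite_vals[OF f])
    ultimately show ?thesis using c by linarith
  next
    case False
    then have "active_values f \<subseteq> Some ` represented f" using sub by blast
    then have c: "card (active_values f) \<le> card (represented f)"
      using card_mono finite_represented[OF f] card_Some by (metis finite_imageI)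
    have "real (card (represented f)) \<le> inverse (alpha P)"
      using card_represented_le[OF f] alpha_bounds(1) by (simp add: field_simps)
    then have "int (card (represented f)) \<le> \<lceil>inverse (alpha P)\<rceil>"
      by linarith
    moreover have "card (represented f) \<le> card (vals P f)"
      using card_mono[OF finite_vals[OF f] represented_subset] .
    ultimately show ?thesis using c by linarith
  qed
  moreover have "card (vals P f) \<le> (MAX f\<in>features P. card (vals P f))"
    using f finite_features by (intro Max_ge) auto
  ultimately show ?thesis by (simp add: gamma_def)
qed

lemma gamma_ge_1:
  assumes f: "f \<in> features P" "vals P f \<noteq> {}"
  shows "1 \<le> gamma P"
proof -
  have "0 < card (vals P f)" using f finite_vals by (simp add: card_gt_0_iff)
  also have "\<dots> \<le> (MAX f\<in>features P. card (vals P f))"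
    using f finite_features by (intro Max_ge) auto
  finally have "1 \<le> (MAX f\<in>features P. card (vals P f))" by simp
  moreover have "0 < \<lceil>inverse (alpha P)\<rceil>" using alpha_bounds by simp
  ultimately show ?thesis unfolding gamma_def by linarith
qed

text \<open>
  A type in \<open>S\<close> is determined by its values at the cluster features other than \<open>f\<close>. A feature
  without represented groups contributes a factor \<open>1 \<le> gamma P\<close> in place of \<open>gamma P\<close>.
\<close>

lemma card_active_types_le:
  assumes f: "f \<in> cluster_features P k" and S: "S \<subseteq> types P k"
    and act: "\<And>t f'. t \<in> S \<Longrightarrow> f' \<in> cluster_features P k \<Longrightarrow> t f' \<in> active_values f'"
    and common: "\<And>t. t \<in> S \<Longrightarrow> t f = v"
  shows "card S \<le> gamma P ^ (card (features P) - 1)"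
proof -
  let ?F = "cluster_features P k - {f}"
  have finF: "finite ?F" using finite_cluster_features by simp
  have sub: "?F \<subseteq> features P - {f}" using cluster_features_subset by blast
  have fF: "f \<in> features P" using f cluster_features_subset by blast
  have fin: "finite (\<Pi>\<^sub>E f'\<in>?F. active_values f')"
    using finF finite_type_values cluster_features_subset
    by (intro finite_PiE) (auto simp: active_values_def)
  have "inj_on (\<lambda>t. restrict t ?F) S"
  proof (rule inj_onI)
    fix t t' assume t: "t \<in> S" "t' \<in> S" "restrict t ?F = restrict t' ?F"
    show "t = t'"
    proof (rule PiE_ext)
      show "t \<in> (\<Pi>\<^sub>E f\<in>cluster_features P k. type_values f)"
        "t' \<in> (\<Pi>\<^sub>E f\<in>cluster_features P k. type_values f)"
        using t S by (auto simp: types_eq)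
    next
      fix f' assume "f' \<in> cluster_features P k"
      then show "t f' = t' f'"
        using common[OF t(1)] common[OF t(2)] fun_cong[OF t(3), of f']
        by (cases "f' = f") auto
    qed
  qed
  moreover have "(\<lambda>t. restrict t ?F) ` S \<subseteq> (\<Pi>\<^sub>E f'\<in>?F. active_values f')"
    using act by (intro image_subsetI) (simp only: restrict_PiE_iff, blast)
  ultimately have "card S \<le> card (\<Pi>\<^sub>E f'\<in>?F. active_values f')"
    using fin by (rule card_inj_on_le)
  also have "\<dots> = (\<Prod>f'\<in>?F. card (active_values f'))"
    using finF by (rule card_PiE)
  also have "\<dots> \<le> (\<Prod>f'\<in>?F. gamma P)"
    using card_active_values_le sub by (intro prod_mono) auto
  also have "\<dots> = gamma P ^ card ?F" by simp
  also have "\<dots> \<le> gamma P ^ (card (features P) - 1)"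
  proof (rule power_increasing)
    have "card ?F \<le> card (features P - {f})"
      using sub finite_features by (intro card_mono) auto
    then show "card ?F \<le> card (features P) - 1" using fF by simp
    show "1 \<le> gamma P"
      using f by (intro gamma_ge_1[OF fF]) (auto simp: cluster_features_def)
  qed
  finally show ?thesis .
qed

lemma card_positive_types_le:
  assumes f: "f \<in> cluster_features P k"
  shows "card {t\<in>{t\<in>types P k. t f = v}. 0 < (\<Sum>i\<in>matching P k t. z i k)}
    \<le> gamma P ^ (card (features P) - 1)"
  using f card_represented_less_if_remainder
  by (intro card_active_types_le[where v = v]) (auto simp: active_values_def types_eq)

lemma active_values_if_not_integral:
  assumes "f \<in> features P" "inverse (alpha P) \<notin> \<int>"
  shows "active_values f = type_values f"
  using card_represented_less_if_not_integral[OF assms] by (auto simp: active_values_def)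

lemma card_types_le_if_not_integral:
  assumes f: "f \<in> cluster_features P k" and nonint: "inverse (alpha P) \<notin> \<int>"
  shows "card {t\<in>types P k. t f = v} \<le> gamma P ^ (card (features P) - 1)"
proof (rule card_active_types_le[OF f, where v = v])
  fix t f' assume "t \<in> {t\<in>types P k. t f = v}" "f' \<in> cluster_features P k"
  then show "t f' \<in> active_values f'"
    using active_values_if_not_integral[OF _ nonint, of f'] cluster_features_subset
    by (auto simp: types_eq)
qed auto

text \<open>
  With at most two values at \<open>f\<close>, the types that avoid \<open>g\<close> all share one value there, so they are
  no more numerous than the types of a single group.
\<close>

lemma card_other_types_le_if_not_integral:
  assumes f: "f \<in> cluster_features P k" and g: "g \<in> represented f"
    and nonint: "inverse (alpha P) \<notin> \<int>" and two: "gamma P \<le> 2"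
  shows "card {t\<in>types P k. t f \<noteq> Some g} \<le> gamma P ^ (card (features P) - 1)"
proof -
  have fF: "f \<in> features P" using f cluster_features_subset by blast
  have fin: "finite (type_values f)" by (rule finite_type_values[OF fF])
  have "card (type_values f) \<le> 2"
    using card_active_values_le[OF fF] active_values_if_not_integral[OF fF nonint] two by simp
  moreover have "Some g \<in> type_values f" using g by (simp add: type_values_def)
  ultimately have "card (type_values f - {Some g}) \<le> 1" by simp
  then obtain v where v: "type_values f - {Some g} \<subseteq> {v}"
    using fin by (metis One_nat_def card_le_Suc0_iff_eq finite_Diff singletonI subsetI)
  have "{t\<in>types P k. t f \<noteq> Some g} \<subseteq> {t\<in>types P k. t f = v}"
    using v f by (auto simp: types_eq)
  then have "card {t\<in>types P k. t f \<noteq> Some g} \<le> card {t\<in>types P k. t f = v}"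
    using finite_types by (intro card_mono) auto
  also have "\<dots> \<le> gamma P ^ (card (features P) - 1)"
    by (rule card_types_le_if_not_integral[OF f nonint])
  finally show ?thesis .
qed


section \<open>The flow through a cluster\<close>

lemma edge_bounds:
  assumes "feasible_flow (flow_apfr P z) \<phi>" "e \<in> edges (flow_apfr P z)"
  shows "0 \<le> \<phi> e" "\<phi> e \<le> 1"
proof -
  have "capacity (flow_apfr P z) e = 1" by (simp add: flow_apfr_def)
  moreover have "0 \<le> \<phi> e \<and> \<phi> e \<le> capacity (flow_apfr P z) e"
    using assms unfolding feasible_flow_def by blast
  ultimately show "0 \<le> \<phi> e" "\<phi> e \<le> 1" by simp_all
qed

lemma type_inflow:
  assumes flow: "feasible_flow (flow_apfr P z) \<phi>" and t: "t \<in> types P k"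
  shows "(\<Sum>i\<in>matching P k t. \<phi> (Point i, Type t k))
    = real_of_int (type_demand P z t k) + \<phi> (Type t k, Cluster k)"
proof -
  let ?N = "flow_apfr P z"
  have out: "{e\<in>edges ?N. fst e = Type t k} = {(Type t k, Cluster k)}"
    using t k by (auto simp: flow_apfr_def)
  have into: "{e\<in>edges ?N. snd e = Type t k} = (\<lambda>i. (Point i, Type t k)) ` matching P k t"
    using t k by (auto simp: flow_apfr_def)
  have "Type t k \<in> nodes ?N" using t k by (simp add: flow_apfr_def)
  moreover have "net_supply ?N (Type t k) = - real_of_int (type_demand P z t k)"
    by (simp add: flow_apfr_def)
  ultimately have "\<phi> (Type t k, Cluster k)
      - (\<Sum>e\<in>(\<lambda>i. (Point i, Type t k)) ` matching P k t. \<phi> e)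
      = - real_of_int (type_demand P z t k)"
    using flow out into unfolding feasible_flow_def by fastforce
  moreover have "(\<Sum>e\<in>(\<lambda>i. (Point i, Type t k)) ` matching P k t. \<phi> e)
      = (\<Sum>i\<in>matching P k t. \<phi> (Point i, Type t k))"
    by (subst sum.reindex) (auto simp: inj_on_def)
  ultimately show ?thesis by simp
qed

lemma type_inflow_bounds:
  assumes flow: "feasible_flow (flow_apfr P z) \<phi>" and t: "t \<in> types P k"
  shows "real_of_int (type_demand P z t k) \<le> (\<Sum>i\<in>matching P k t. \<phi> (Point i, Type t k))"
    and "(\<Sum>i\<in>matching P k t. \<phi> (Point i, Type t k)) \<le> real_of_int (type_demand P z t k) + 1"
proof -
  have "(Type t k, Cluster k) \<in> edges (flow_apfr P z)"
    using t k by (simp add: flow_apfr_def)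
  then show "real_of_int (type_demand P z t k) \<le> (\<Sum>i\<in>matching P k t. \<phi> (Point i, Type t k))"
    and "(\<Sum>i\<in>matching P k t. \<phi> (Point i, Type t k)) \<le> real_of_int (type_demand P z t k) + 1"
    using edge_bounds[OF flow] type_inflow[OF flow t] by auto
qed

text \<open>
  Apart from what is demanded inside the cluster, which adds up to the floor of its mass, flow can
  leave only along the edge to the sink. That edge has capacity \<open>1\<close> and exists only if
  the mass is not an integer.
\<close>

lemma cluster_inflow_le:
  assumes flow: "feasible_flow (flow_apfr P z) \<phi>"
  shows "(\<Sum>t\<in>types P k. \<Sum>i\<in>matching P k t. \<phi> (Point i, Type t k))
    \<le> real_of_int \<lceil>\<Sum>i\<in>points P. z i k\<rceil>"
proof -
  let ?N = "flow_apfr P z" and ?s = "\<Sum>i\<in>points P. z i k"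
  have into: "{e\<in>edges ?N. snd e = Cluster k} = (\<lambda>t. (Type t k, Cluster k)) ` types P k"
    using k by (auto simp: flow_apfr_def)
  have out: "{e\<in>edges ?N. fst e = Cluster k} = (if ?s \<in> \<int> then {} else {(Cluster k, Sink)})"
    using k by (auto simp: flow_apfr_def)
  have "Cluster k \<in> nodes ?N" using k by (simp add: flow_apfr_def)
  moreover have "net_supply ?N (Cluster k) = - real_of_int (cluster_demand P z k)"
    by (simp add: flow_apfr_def)
  ultimately have "(\<Sum>e\<in>{e\<in>edges ?N. fst e = Cluster k}. \<phi> e)
      - (\<Sum>e\<in>(\<lambda>t. (Type t k, Cluster k)) ` types P k. \<phi> e)
      = - real_of_int (cluster_demand P z k)"
    using flow into unfolding feasible_flow_def by fastforce
  moreover have "(\<Sum>e\<in>(\<lambda>t. (Type t k, Cluster k)) ` types P k. \<phi> e)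
      = (\<Sum>t\<in>types P k. \<phi> (Type t k, Cluster k))"
    by (subst sum.reindex) (auto simp: inj_on_def)
  ultimately have "(\<Sum>t\<in>types P k. \<phi> (Type t k, Cluster k))
      = real_of_int (cluster_demand P z k) + (\<Sum>e\<in>{e\<in>edges ?N. fst e = Cluster k}. \<phi> e)"
    by simp
  then have "(\<Sum>t\<in>types P k. \<Sum>i\<in>matching P k t. \<phi> (Point i, Type t k))
      = real_of_int \<lfloor>?s\<rfloor> + (\<Sum>e\<in>{e\<in>edges ?N. fst e = Cluster k}. \<phi> e)"
    using type_inflow[OF flow] by (simp add: sum.distrib cluster_demand_def)
  moreover have "(\<Sum>e\<in>{e\<in>edges ?N. fst e = Cluster k}. \<phi> e)
      \<le> real_of_int \<lceil>?s\<rceil> - real_of_int \<lfloor>?s\<rfloor>"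
  proof (cases "?s \<in> \<int>")
    case True
    then show ?thesis unfolding out by simp
  next
    case False
    then have "(Cluster k, Sink) \<in> edges ?N" using k by (simp add: flow_apfr_def)
    then have "\<phi> (Cluster k, Sink) \<le> 1" using edge_bounds[OF flow] by simp
    moreover have "\<lceil>?s\<rceil> = \<lfloor>?s\<rfloor> + 1" using False by (metis Ints_of_int ceiling_altdef)
    ultimately show ?thesis unfolding out using False by simp
  qed
  ultimately show ?thesis by linarith
qed

text \<open>
  Integrality and unit capacity force the flow on the edge to be \<open>0\<close> or \<open>1\<close>, and a point matches
  only one type of the cluster.
\<close>

lemma flow_assignment_eq_flow:
  assumes flow: "feasible_flow (flow_apfr P z) \<phi>" and int: "integral_flow (flow_apfr P z) \<phi>"
    and t: "t \<in> types P k" and i: "i \<in> matching P k t"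
  shows "flow_assignment P \<phi> i k = \<phi> (Point i, Type t k)"
proof -
  have e: "(Point i, Type t k) \<in> edges (flow_apfr P z)"
    using t i k by (simp add: flow_apfr_def)
  then obtain n where n: "\<phi> (Point i, Type t k) = real_of_int n"
    using int unfolding integral_flow_def by (auto elim: Ints_cases)
  then have "n = 0 \<or> n = 1" using edge_bounds[OF flow e] by auto
  moreover have "(\<exists>t'\<in>types P k. i \<in> matching P k t' \<and> \<phi> (Point i, Type t' k) = 1)
      \<longleftrightarrow> \<phi> (Point i, Type t k) = 1"
    using t i type_unique by blast
  ultimately show ?thesis using n by (auto simp: flow_assignment_def)
qed

lemma fairness_lhs_flow_assignment_le:
  assumes flow: "feasible_flow (flow_apfr P z) \<phi>" and int: "integral_flow (flow_apfr P z) \<phi>"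
    and f: "f \<in> features P" and g: "g \<in> vals P f" and rep: "rep P g k = 1"
  shows "fairness_lhs P g k (flow_assignment P \<phi>)
    \<le> real (gamma P) ^ (card (features P) - 1) + alpha P * (if gamma P > 2 then 1 else 0)"
proof -
  define T where "T = types P k"
  define U where "U = {t\<in>T. t f = Some g}"
  define a where "a t = (\<Sum>i\<in>matching P k t. z i k)" for t
  define x where "x t = (\<Sum>i\<in>matching P k t. \<phi> (Point i, Type t k))" for t
  define N where "N = gamma P ^ (card (features P) - 1)"
  define s where "s = (\<Sum>i\<in>points P. z i k)"
  have fk: "f \<in> cluster_features P k" and gk: "g \<in> represented f"
    using f g rep by (auto simp: cluster_features_def represented_def)
  have finT: "finite T" and UT: "U \<subseteq> T" using finite_types by (auto simp: T_def U_def)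
  have finU: "finite U" using finT UT by (rule rev_finite_subset)
  have x_eq: "(\<Sum>i\<in>matching P k t. flow_assignment P \<phi> i k) = x t" if "t \<in> T" for t
    using flow_assignment_eq_flow[OF flow int] that by (simp add: x_def T_def)
  have lhs: "fairness_lhs P g k (flow_assignment P \<phi>) = alpha P * sum x T - sum x U"
    unfolding fairness_lhs_def sum_points_by_type sum_members_by_type[OF fk gk]
    using x_eq by (simp add: T_def U_def)
  have s: "s = sum a T" by (simp add: s_def a_def T_def sum_points_by_type)
  have "sum a U = (\<Sum>i\<in>members P g. z i k)"
    unfolding sum_members_by_type[OF fk gk] by (simp add: a_def U_def T_def)
  then have fair: "alpha P * s \<le> sum a U"
    using fair_lp[OF f gk] by (simp add: s_def)
  have nonneg: "0 \<le> a t" for t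
    using z_nonneg by (auto simp: a_def matching_eq intro: sum_nonneg)
  have pos: "card {t\<in>U. 0 < a t} \<le> N"
    using card_positive_types_le[OF fk] by (simp add: U_def T_def a_def N_def)
  have lb: "real_of_int \<lfloor>a t\<rfloor> \<le> x t" and ub: "x t \<le> real_of_int \<lfloor>a t\<rfloor> + 1" if "t \<in> T" for t
    using type_inflow_bounds[OF flow] that by (auto simp: T_def a_def x_def type_demand_def)
  have X: "sum x T \<le> real_of_int \<lceil>s\<rceil>"
    using cluster_inflow_le[OF flow] by (simp add: s_def x_def T_def)
  have "alpha P * sum x T - sum x U \<le> real N + alpha P * (if gamma P > 2 then 1 else 0)"
  proof (cases "gamma P > 2")
    case True
    then show ?thesis
      using rounding_violation_le_card_plus_alpha
        [OF finU nonneg pos alpha_bounds(1) fair _ X] lb UT by auto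
  next
    case False
    have "alpha P * sum x T - sum x U \<le> real N"
    proof (cases "inverse (alpha P) \<in> \<int>")
      case True
      then show ?thesis
        using rounding_violation_le_card_if_inverse_integral
          [OF finU nonneg pos alpha_bounds(1) _ fair _ X] lb UT by auto
    next
      case nonint: False
      have "card U \<le> N"
        using card_types_le_if_not_integral[OF fk nonint] by (simp add: U_def T_def N_def)
      moreover have "T - U = {t\<in>T. t f \<noteq> Some g}" by (auto simp: U_def)
      then have "card (T - U) \<le> N"
        using card_other_types_le_if_not_integral[OF fk gk nonint] False
        by (simp add: T_def N_def)
      ultimately show ?thesis
        using finT UT alpha_bounds fair lb ub
        by (intro rounding_violation_le_card_if_balanced) (auto simp: s)
    qed
    then show ?thesis using False by simp
  qed
  then show ?thesis by (simp add: lhs N_def)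
qed

end


section \<open>The fairness guarantee\<close>

theorem theorem6:
  fixes P :: "('f, 'g, 'm::finite) apfr"
    and zLP :: "nat \<Rightarrow> nat \<Rightarrow> real"
    and \<phi> :: "('f, 'g) node \<times> ('f, 'g) node \<Rightarrow> real"
  assumes "apfr_instance P"
    and "lp_optimal P zLP"
    and "min_cost_flow (flow_apfr P zLP) \<phi>"
    and "integral_flow (flow_apfr P zLP) \<phi>"
  shows "\<forall>g\<in>groups P. \<forall>k\<in>clusters P. rep P g k = 1 \<longrightarrow>
    additive_violation (fairness_lhs P g k) (flow_assignment P \<phi>)
      (real (gamma P) ^ (card (features P) - 1) + alpha P * (if gamma P > 2 then 1 else 0))"
proof (intro ballI impI)
  fix g k assume g: "g \<in> groups P" and k: "k \<in> clusters P" and rep: "rep P g k = 1"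
  interpret fair_cluster P zLP k
    using assms(1,2) k by unfold_locales (auto simp: lp_optimal_def)
  obtain f where f: "f \<in> features P" "g \<in> vals P f" using g by (auto simp: groups_def)
  have "feasible_flow (flow_apfr P zLP) \<phi>" using assms(3) by (simp add: min_cost_flow_def)
  then show "additive_violation (fairness_lhs P g k) (flow_assignment P \<phi>)
      (real (gamma P) ^ (card (features P) - 1) + alpha P * (if gamma P > 2 then 1 else 0))"
    using fairness_lhs_flow_assignment_le[OF _ assms(4) f rep] alpha_bounds(1)
    unfolding additive_violation_def by simp
qed

end
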